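(* For a Tychonoff space $X$, the following assertions are equivalent: (i) $X$ is a weakly open-compact attainable space; (ii) the natural inclusion map $I:\bigoplus\mathcal{K}(X)\to X$ is a weakly $\kappa$-pseudo open map; (iii) $X$ is the image of some locally compact space under a weakly $\kappa$-pseudo open map; (iv) $X$ is the image of some $k$-space under a weakly $\kappa$-pseudo open map; (v) $X$ is the image of some $k_{\mathbb{R}}$-space under a weakly $\kappa$-pseudo open map.
   Context: All topological spaces are assumed to be Tychonoff. $\mathcal{K}(X)$ is the family of all compact subsets of $X$, $\bigoplus\mathcal{K}(X)=\bigoplus_{K\in\mathcal{K}(X)}K$ is the topological sum (disjoint union) of all of them, and $I$ is the map whose restriction to each summand $K$ is the inclusion $K\hookrightarrow X$. A space $X$ is weakly open-compact attainable if for every non-closed open $W\subseteq X$ there are a point $z\in\overline{W}\setminus W$ and a compact $K\subseteq X$ such that $z\in K\cap\overline{K\cap W}$. A surjective continuous map $f:X\to Y$ is called weakly $\kappa$-pseudo open if an open set $U\subseteq Y$ is closed in $Y$ if and only if $f^{-1}(U)$ is closed in $X$. A space $X$ is a $k$-space if for each non-closed $A\subseteq X$ there is a compact $K\subseteq X$ such that $A\cap K$ is not closed in $K$; it is a $k_{\mathbb{R}}$-space if every function $f:X\to\mathbb{R}$ whose restriction to each compact subset of $X$ is continuous is itself continuous. *)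

theory Defs
  imports "HOL-Analysis.Analysis"
begin

definition Tychonoff_space :: "'a topology \<Rightarrow> bool" where
  "Tychonoff_space X \<longleftrightarrow> completely_regular_space X \<and> Hausdorff_space X"

definition weakly_open_compact_attainable :: "'a topology \<Rightarrow> bool" where
  "weakly_open_compact_attainable X \<longleftrightarrow>
     (\<forall>W. openin X W \<and> \<not> closedin X W \<longrightarrow>
        (\<exists>z \<in> X closure_of W - W. \<exists>K. compactin X K \<and> z \<in> K \<inter> X closure_of (K \<inter> W)))"

definition weakly_kappa_pseudo_open_map ::
    "'a topology \<Rightarrow> 'b topology \<Rightarrow> ('a \<Rightarrow> 'b) \<Rightarrow> bool" where
  "weakly_kappa_pseudo_open_map X Y f \<longleftrightarrow>
     continuous_map X Y f \<and> f ` topspace X = topspace Y \<and>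
     (\<forall>U. openin Y U \<longrightarrow> (closedin Y U \<longleftrightarrow> closedin X {x \<in> topspace X. f x \<in> U}))"

definition kR_space :: "'a topology \<Rightarrow> bool" where
  "kR_space X \<longleftrightarrow>
     (\<forall>f::'a \<Rightarrow> real.
        (\<forall>K. compactin X K \<longrightarrow> continuous_map (subtopology X K) euclideanreal f)
          \<longrightarrow> continuous_map X euclideanreal f)"

definition compact_sum :: "'a topology \<Rightarrow> ('a set \<times> 'a) topology" where
  "compact_sum X = sum_topology (\<lambda>K. subtopology X K) {K. compactin X K}"

(* The map I: a point of the summand indexed by K is a pair (K, x). *)
definition compact_sum_map :: "'a set \<times> 'a \<Rightarrow> 'a" where
  "compact_sum_map = snd"

(* The type variable 'b of P is the type carrying the points of the domain spaces; a formula of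
   HOL can only quantify over spaces living on one given type. *)
definition weakly_kappa_pseudo_open_image ::
    "('b topology \<Rightarrow> bool) \<Rightarrow> 'a topology \<Rightarrow> bool" where
  "weakly_kappa_pseudo_open_image P X \<longleftrightarrow>
     (\<exists>Y f. Tychonoff_space Y \<and> P Y \<and> weakly_kappa_pseudo_open_map Y X f)"

end

(* The preimage of an open, non-closed set W under a weakly kappa-pseudo-open map from a
   k_R-space is open but not closed, so its indicator function is discontinuous on some compact K.
   A point of K in the boundary of the preimage is mapped to a point that witnesses attainability,
   with the image of K as compact set. Conversely, attainability says exactly that an open set is
   closed as soon as its traces on all compact sets are, that is, as soon as its preimage in the
   sum of the compact subsets, a locally compact space, is closed. *)

theory Submission
  imports Defs
begin

text \<open>The component injections are open maps. Two points of one summand are separated there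
  and the separating sets are carried over; points of different summands are separated by the
  summands themselves.\<close>

lemma Hausdorff_space_sum_topology:
  assumes "\<And>i. i \<in> I \<Longrightarrow> Hausdorff_space (X i)"
  shows "Hausdorff_space (sum_topology X I)"
  unfolding Hausdorff_space_def
proof (intro allI impI, elim conjE)
  fix p q
  assume p: "p \<in> topspace (sum_topology X I)" and q: "q \<in> topspace (sum_topology X I)"
    and "p \<noteq> q"
  obtain i x where ix: "p = (i, x)" "i \<in> I" "x \<in> topspace (X i)"
    using p by auto
  obtain j y where jy: "q = (j, y)" "j \<in> I" "y \<in> topspace (X j)"
    using q by auto
  have op: "openin (sum_topology X I) (Pair k ` U)" if "k \<in> I" "openin (X k) U" for k U
    using open_map_component_injection[of k I X] that by (simp add: open_map_def)
  show "\<exists>U V. openin (sum_topology X I) U \<and> openin (sum_topology X I) V \<and>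
          p \<in> U \<and> q \<in> V \<and> disjnt U V"
  proof (cases "i = j")
    case True
    with \<open>p \<noteq> q\<close> ix jy obtain U V
      where UV: "openin (X i) U" "openin (X i) V" "x \<in> U" "y \<in> V" "disjnt U V"
      using assms[of i] unfolding Hausdorff_space_def by blast
    have "openin (sum_topology X I) (Pair i ` U)" "openin (sum_topology X I) (Pair i ` V)"
      using UV ix(2) op by auto
    moreover have "disjnt (Pair i ` U) (Pair i ` V)"
      using UV(5) by (auto simp: disjnt_iff)
    ultimately show ?thesis
      using UV ix jy True by blast
  next
    case False
    have "openin (sum_topology X I) (Pair i ` topspace (X i))"
      "openin (sum_topology X I) (Pair j ` topspace (X j))"
      using ix(2) jy(2) op by auto
    moreover have "disjnt (Pair i ` topspace (X i)) (Pair j ` topspace (X j))"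
      using False by (auto simp: disjnt_iff)
    ultimately show ?thesis
      using ix jy by blast
  qed
qed

lemma locally_compact_space_compact_sum: "locally_compact_space (compact_sum X)"
  unfolding compact_sum_def
  by (simp add: compact_imp_locally_compact_space compact_space_subtopology
      locally_compact_space_sum_topology)

text \<open>\<open>weakly_kappa_pseudo_open_image\<close> asks for a Tychonoff domain. Complete
  regularity comes from local compactness together with the Hausdorff property, which passes from
  \<open>X\<close> to its subspaces and to their sum.\<close>

lemma Tychonoff_space_compact_sum:
  assumes "Hausdorff_space X"
  shows "Tychonoff_space (compact_sum X)"
proof -
  have "Hausdorff_space (compact_sum X)"
    unfolding compact_sum_def
    by (intro Hausdorff_space_sum_topology Hausdorff_space_subtopology assms)
  then show ?thesis
    using locally_compact_space_compact_sum locally_compact_regular_imp_completely_regular_space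
    unfolding Tychonoff_space_def by blast
qed

text \<open>This \<open>Sigma\<close> form exposes the slice at each index \<open>K\<close>, on
  which openness and closedness in the sum are tested.\<close>

lemma compact_sum_map_vimage:
  assumes "U \<subseteq> topspace X"
  shows "{p \<in> topspace (compact_sum X). compact_sum_map p \<in> U} =
    Sigma {K. compactin X K} (\<lambda>K. K \<inter> U)"
  using assms by (auto simp: compact_sum_def compact_sum_map_def)

lemma openin_compact_sum_map_vimage:
  assumes "openin X U"
  shows "openin (compact_sum X) {p \<in> topspace (compact_sum X). compact_sum_map p \<in> U}"
  unfolding compact_sum_map_vimage[OF openin_subset[OF assms]]
  unfolding compact_sum_def openin_disjoint_union
  using assms by (simp add: openin_subtopology_Int2)

lemma closedin_compact_sum_map_vimage_iff:
  assumes "U \<subseteq> topspace X"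
  shows "closedin (compact_sum X) {p \<in> topspace (compact_sum X). compact_sum_map p \<in> U} \<longleftrightarrow>
    (\<forall>K. compactin X K \<longrightarrow> closedin (subtopology X K) (K \<inter> U))"
proof -
  have "Sigma {K. compactin X K} (\<lambda>K. K \<inter> U) \<subseteq>
      Sigma {K. compactin X K} (topspace \<circ> subtopology X)"
    using assms by auto
  moreover have "{x. (K, x) \<in> Sigma {K. compactin X K} (\<lambda>K. K \<inter> U)} = K \<inter> U"
    if "compactin X K" for K
    using that by auto
  ultimately show ?thesis
    unfolding compact_sum_map_vimage[OF assms]
    unfolding compact_sum_def closedin_sum_topology by simp
qed

lemma continuous_map_compact_sum_map: "continuous_map (compact_sum X) X compact_sum_map"
  unfolding continuous_map_def
proof (intro conjI allI impI)
  show "compact_sum_map \<in> topspace (compact_sum X) \<rightarrow> topspace X"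
    by (auto simp: compact_sum_def compact_sum_map_def)
qed (rule openin_compact_sum_map_vimage)

lemma compact_sum_map_surj: "compact_sum_map ` topspace (compact_sum X) = topspace X"
proof
  show "compact_sum_map ` topspace (compact_sum X) \<subseteq> topspace X"
    by (auto simp: compact_sum_def compact_sum_map_def)
  show "topspace X \<subseteq> compact_sum_map ` topspace (compact_sum X)"
  proof
    fix x assume "x \<in> topspace X"
    \<comment> \<open>Singletons are compact, so every point occurs in some summand.\<close>
    then have "({x}, x) \<in> topspace (compact_sum X)"
      by (simp add: compact_sum_def)
    then show "x \<in> compact_sum_map ` topspace (compact_sum X)"
      by (force simp: compact_sum_map_def)
  qed
qed

lemma weakly_kappa_pseudo_open_map_compact_sum_map:
  assumes "Hausdorff_space X" and "weakly_open_compact_attainable X"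
  shows "weakly_kappa_pseudo_open_map (compact_sum X) X compact_sum_map"
  unfolding weakly_kappa_pseudo_open_map_def
proof (intro conjI allI impI iffI)
  fix U
  assume U: "openin X U"
    and "closedin (compact_sum X) {p \<in> topspace (compact_sum X). compact_sum_map p \<in> U}"
  then have sub: "closedin (subtopology X K) (K \<inter> U)" if "compactin X K" for K
    using that closedin_compact_sum_map_vimage_iff[OF openin_subset[OF U]] by simp
  \<comment> \<open>The Hausdorff property makes \<open>K\<close> closed in \<open>X\<close>, so
    closed subsets of \<open>K\<close> are closed in \<open>X\<close>. Hence
    \<open>K \<inter> U\<close> is its own closure and contains no point outside \<open>U\<close>,
    which rules out an attainability witness for \<open>U\<close>.\<close>
  have "closedin X (K \<inter> U)" if "compactin X K" for K
    using closedin_trans_full[OF sub[OF that] compactin_imp_closedin[OF assms(1) that]] .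
  then have "X closure_of (K \<inter> U) = K \<inter> U" if "compactin X K" for K
    using that by (simp add: closure_of_closedin)
  then show "closedin X U"
    using assms(2) U unfolding weakly_open_compact_attainable_def by blast
qed (simp_all add: continuous_map_compact_sum_map compact_sum_map_surj
      closedin_continuous_map_preimage[OF continuous_map_compact_sum_map])

lemma k_space_imp_kR_space: "k_space X \<Longrightarrow> kR_space X"
  unfolding kR_space_def using continuous_map_from_k_space by blast

lemma weakly_open_compact_attainable_image:
  assumes "kR_space Y" and "weakly_kappa_pseudo_open_map Y X f"
  shows "weakly_open_compact_attainable X"
  unfolding weakly_open_compact_attainable_def
proof (intro allI impI, elim conjE)
  fix W assume W: "openin X W" "\<not> closedin X W"
  define V where "V = {y \<in> topspace Y. f y \<in> W}"
  have f: "continuous_map Y X f" and ncl: "\<not> closedin Y V"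
    using assms(2) W unfolding weakly_kappa_pseudo_open_map_def V_def by blast+
  have opV: "openin Y V"
    using f W(1) unfolding V_def by (rule openin_continuous_map_preimage)
  \<comment> \<open>\<open>V\<close> is the preimage of the closed set \<open>{1}\<close> under its
    indicator, so continuity would make \<open>V\<close> closed.\<close>
  have "\<not> continuous_map Y euclideanreal (indicator V)"
  proof
    assume "continuous_map Y euclideanreal (indicator V)"
    then have "closedin Y {y \<in> topspace Y. (indicator V y :: real) \<in> {1}}"
      by (rule closedin_continuous_map_preimage) simp
    moreover have "{y \<in> topspace Y. (indicator V y :: real) \<in> {1}} = V"
      by (auto simp: V_def indicator_def)
    ultimately show False
      using ncl by simp
  qed
  then obtain K where K: "compactin Y K"
    and disc: "\<not> continuous_map (subtopology Y K) euclideanreal (indicator V)"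
    using assms(1) unfolding kR_space_def by blast
  \<comment> \<open>Otherwise \<open>K \<inter> V\<close> would be clopen in \<open>K\<close>, and
    the indicator, constant on it and on \<open>K - V\<close>, would be continuous on
    \<open>K\<close>.\<close>
  have "\<not> closedin (subtopology Y K) (K \<inter> V)"
  proof
    assume cl: "closedin (subtopology Y K) (K \<inter> V)"
    have top: "topspace (subtopology Y K) = K"
      using K compactin_subset_topspace by fastforce
    have "openin (subtopology Y K) (K - K \<inter> V)"
      using openin_diff[OF openin_topspace cl] unfolding top .
    moreover have "K - K \<inter> V = K - V"
      by blast
    ultimately have op: "openin (subtopology Y K) (K \<inter> V)" "openin (subtopology Y K) (K - V)"
      using opV by (simp_all add: openin_subtopology_Int2)
    have "continuous_map (subtopology Y K) euclideanreal (indicator V)"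
      unfolding continuous_map_def
    proof (intro conjI allI impI)
      fix U :: "real set"
      have "{y \<in> K. indicator V y \<in> U} =
          (if 1 \<in> U then K \<inter> V else {}) \<union> (if 0 \<in> U then K - V else {})"
        by (auto simp: indicator_def)
      then show "openin (subtopology Y K) {y \<in> topspace (subtopology Y K). indicator V y \<in> U}"
        unfolding top using op by (auto intro!: openin_Un)
    qed auto
    with disc show False ..
  qed
  \<comment> \<open>The set \<open>K \<inter> V\<close> is not closed in \<open>K\<close> but lies
    in the relatively closed set \<open>K \<inter> Y closure_of (K \<inter> V)\<close>. The
    inclusion is therefore proper, which yields the point \<open>y\<close>.\<close>
  moreover have "K \<inter> V \<subseteq> K \<inter> Y closure_of (K \<inter> V)"
    using closure_of_subset[of "K \<inter> V" Y] by (auto simp: V_def)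
  moreover have "closedin (subtopology Y K) (K \<inter> Y closure_of (K \<inter> V))"
    by (simp add: closedin_subtopology_Int_closed)
  ultimately have "\<not> K \<inter> Y closure_of (K \<inter> V) \<subseteq> K \<inter> V"
    by (metis subset_antisym)
  then obtain y where y: "y \<in> K" "y \<in> Y closure_of (K \<inter> V)" "y \<notin> V"
    by blast
  have "y \<in> topspace Y"
    using y(1) K compactin_subset_topspace by blast
  then have nW: "f y \<notin> W"
    using y(3) by (simp add: V_def)
  \<comment> \<open>A continuous map sends the closure of a set into the closure of its image, and
    \<open>f\<close> maps \<open>K \<inter> V\<close> into \<open>f\<close> K \<inter>
    W\<open>. So\<close>f y\<open>and\<close>f \<open>K\<close> serve as the witnesses.\<close>
  have "f y \<in> X closure_of f ` (K \<inter> V)"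
    using continuous_map_image_closure_subset[OF f] y(2) by blast
  then have cl: "f y \<in> X closure_of (f ` K \<inter> W)"
    using closure_of_mono[of "f ` (K \<inter> V)" "f ` K \<inter> W" X] by (auto simp: V_def)
  then have "f y \<in> X closure_of W"
    using closure_of_mono[of "f ` K \<inter> W" W X] by blast
  moreover have "compactin X (f ` K)"
    using K f by (rule image_compactin)
  ultimately show "\<exists>z \<in> X closure_of W - W. \<exists>K. compactin X K \<and> z \<in> K \<inter> X closure_of (K \<inter> W)"
    using nW cl y(1) by blast
qed

lemma weakly_kappa_pseudo_open_image_mono:
  assumes "weakly_kappa_pseudo_open_image P X" and "\<And>Y. P Y \<Longrightarrow> Q Y"
  shows "weakly_kappa_pseudo_open_image Q X"
  using assms unfolding weakly_kappa_pseudo_open_image_def by blast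

text \<open>Locally compact spaces are k-spaces and these are \<open>kR_space\<close>s, so all three
  cases reduce to the last. The carrier type \<open>'b\<close> stays arbitrary.\<close>

lemma weakly_kappa_pseudo_open_image_imp_attainable:
  fixes X :: "'a topology"
  assumes "weakly_kappa_pseudo_open_image (locally_compact_space :: 'b topology \<Rightarrow> bool) X \<or>
    weakly_kappa_pseudo_open_image (k_space :: 'b topology \<Rightarrow> bool) X \<or>
    weakly_kappa_pseudo_open_image (kR_space :: 'b topology \<Rightarrow> bool) X"
  shows "weakly_open_compact_attainable X"
proof -
  have "weakly_kappa_pseudo_open_image (kR_space :: 'b topology \<Rightarrow> bool) X"
    using assms
    by (auto elim!: weakly_kappa_pseudo_open_image_mono
        intro: locally_compact_imp_k_space k_space_imp_kR_space)
  then show ?thesis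
    using weakly_open_compact_attainable_image
    unfolding weakly_kappa_pseudo_open_image_def by blast
qed

lemma weakly_kappa_pseudo_open_image_compact_sum:
  fixes X :: "'a topology"
  assumes "Hausdorff_space X"
    and "weakly_kappa_pseudo_open_map (compact_sum X) X compact_sum_map"
  shows "weakly_kappa_pseudo_open_image
    (locally_compact_space :: ('a set \<times> 'a) topology \<Rightarrow> bool) X"
  using assms Tychonoff_space_compact_sum locally_compact_space_compact_sum
  unfolding weakly_kappa_pseudo_open_image_def by blast

text \<open>The equivalences use the type \<open>'a set \<times> 'a\<close>, on which the witness
  \<open>compact_sum X\<close> lives. The implications over \<open>'b\<close> extend the converse
  directions to domains on any type.\<close>

theorem theorem5p2:
  fixes X :: "'a topology"
  assumes "Tychonoff_space X"
  shows
    "((weakly_open_compact_attainable X \<longleftrightarrow>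
         weakly_kappa_pseudo_open_map (compact_sum X) X compact_sum_map) \<and>
      (weakly_open_compact_attainable X \<longleftrightarrow>
         weakly_kappa_pseudo_open_image
           (locally_compact_space :: ('a set \<times> 'a) topology \<Rightarrow> bool) X) \<and>
      (weakly_open_compact_attainable X \<longleftrightarrow>
         weakly_kappa_pseudo_open_image (k_space :: ('a set \<times> 'a) topology \<Rightarrow> bool) X) \<and>
      (weakly_open_compact_attainable X \<longleftrightarrow>
         weakly_kappa_pseudo_open_image (kR_space :: ('a set \<times> 'a) topology \<Rightarrow> bool) X)) \<and>
     ((weakly_kappa_pseudo_open_image (locally_compact_space :: 'b topology \<Rightarrow> bool) X \<longrightarrow>
         weakly_open_compact_attainable X) \<and>
      (weakly_kappa_pseudo_open_image (k_space :: 'b topology \<Rightarrow> bool) X \<longrightarrow>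
         weakly_open_compact_attainable X) \<and>
      (weakly_kappa_pseudo_open_image (kR_space :: 'b topology \<Rightarrow> bool) X \<longrightarrow>
         weakly_open_compact_attainable X))"
proof -
  have H: "Hausdorff_space X"
    using assms by (simp add: Tychonoff_space_def)
  note lc_k = locally_compact_imp_k_space and k_kR = k_space_imp_kR_space
  have sum: "weakly_open_compact_attainable X \<longleftrightarrow>
      weakly_kappa_pseudo_open_map (compact_sum X) X compact_sum_map"
    using weakly_kappa_pseudo_open_map_compact_sum_map[OF H]
      \<comment> \<open>The sum is locally compact, hence a \<open>kR_space\<close>, so the result
        on images applies to it.\<close>
      weakly_open_compact_attainable_image[OF k_kR[OF lc_k[OF locally_compact_space_compact_sum]]]
    by blast
  have lc: "weakly_kappa_pseudo_open_image
      (locally_compact_space :: ('a set \<times> 'a) topology \<Rightarrow> bool) X"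
    if "weakly_open_compact_attainable X"
    using weakly_kappa_pseudo_open_image_compact_sum[OF H] that sum by blast
  have k: "weakly_kappa_pseudo_open_image (k_space :: ('a set \<times> 'a) topology \<Rightarrow> bool) X"
    if "weakly_open_compact_attainable X"
    using lc[OF that] lc_k by (rule weakly_kappa_pseudo_open_image_mono)
  have kR: "weakly_kappa_pseudo_open_image (kR_space :: ('a set \<times> 'a) topology \<Rightarrow> bool) X"
    if "weakly_open_compact_attainable X"
    using k[OF that] k_kR by (rule weakly_kappa_pseudo_open_image_mono)
  show ?thesis
    using sum lc k kR
      \<comment> \<open>The first instance closes the equivalences, the second gives the
        implications over \<open>'b\<close>.\<close>
      weakly_kappa_pseudo_open_image_imp_attainable[where 'b = "'a set \<times> 'a" and X = X]
      weakly_kappa_pseudo_open_image_imp_attainable[where 'b = 'b and X = X]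
    by blast
qed

end
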